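(* The following inequalities hold for the discrete Ricci curvature of the Hasse diagrams of the Bruhat orders of the finite Coxeter groups of types $F_4$, $E_6$ and $H_3$: $$\mathrm{Ric}(H(F_4))\geq -28,\qquad \mathrm{Ric}(H(E_6))\geq -46,\qquad \mathrm{Ric}(H(H_3))\geq -14.$$
   Context: Ricci curvature. Let $G$ be a simple undirected graph (no loops, no multiple edges) that is locally finite and has no isolated vertices, with vertex set $\mathcal V(G)$; $B(1,x)$ is the set of neighbours of $x$. For real functions $f,g$ on $\mathcal V(G)$ and $x\in\mathcal V(G)$ put $\Delta(f)(x)=\sum_{v\in B(1,x)}(f(v)-f(x))$, $\Gamma(f,g)(x)=\frac12\sum_{v\in B(1,x)}(f(x)-f(v))(g(x)-g(v))$, $\Gamma(f)=\Gamma(f,f)$, and $\Gamma_2(f)(x)=\frac12\Delta(\Gamma(f,f))(x)-\Gamma(f,\Delta(f))(x)$. The discrete Ricci curvature $\mathrm{Ric}(G)$ is the maximum $K\in\mathbb R\cup\{-\infty\}$ such that $\Gamma_2(f)(x)\ge K\,\Gamma(f)(x)$ for every real function $f$ on $\mathcal V(G)$ and every vertex $x$. Bruhat order. For a Coxeter system $(W,S)$, $\ell$ is the length function with respect to $S$ and $T=\bigcup_{w\in W}wSw^{-1}$. The Bruhat order on $W$ is the partial order generated by the relations $tw<w$ for $w\in W$, $t\in T$ with $\ell(tw)<\ell(w)$. $H(W)$ is the undirected graph with vertex set $W$ in which two elements are joined by an edge iff one covers the other in the Bruhat order. $F_4$, $E_6$, $H_3$ denote the finite irreducible Coxeter groups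 of these types in the standard classification, with their standard Coxeter generators. *)

theory Defs
  imports "HOL-Analysis.Analysis" "HOL-Algebra.Group"
begin

section \<open>Discrete Ricci curvature\<close>

text \<open>A graph is given by its vertex set \<open>V\<close> and its adjacency relation \<open>adj\<close>. For a locally
  finite graph all sums below are finite, and at a vertex they depend only on the values of
  the functions on \<open>V\<close>.\<close>

definition nbhd :: "'a set \<Rightarrow> ('a \<Rightarrow> 'a \<Rightarrow> bool) \<Rightarrow> 'a \<Rightarrow> 'a set" where
  "nbhd V adj x = {v \<in> V. adj x v}"

definition laplacian ::
    "'a set \<Rightarrow> ('a \<Rightarrow> 'a \<Rightarrow> bool) \<Rightarrow> ('a \<Rightarrow> real) \<Rightarrow> 'a \<Rightarrow> real" where
  "laplacian V adj f x = (\<Sum>v \<in> nbhd V adj x. f v - f x)"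

definition gamma ::
    "'a set \<Rightarrow> ('a \<Rightarrow> 'a \<Rightarrow> bool) \<Rightarrow> ('a \<Rightarrow> real) \<Rightarrow> ('a \<Rightarrow> real) \<Rightarrow> 'a \<Rightarrow> real" where
  "gamma V adj f g x = 1 / 2 * (\<Sum>v \<in> nbhd V adj x. (f x - f v) * (g x - g v))"

definition gamma2 ::
    "'a set \<Rightarrow> ('a \<Rightarrow> 'a \<Rightarrow> bool) \<Rightarrow> ('a \<Rightarrow> real) \<Rightarrow> 'a \<Rightarrow> real" where
  "gamma2 V adj f x =
     1 / 2 * laplacian V adj (gamma V adj f f) x - gamma V adj f (laplacian V adj f) x"

definition curvature_bound :: "'a set \<Rightarrow> ('a \<Rightarrow> 'a \<Rightarrow> bool) \<Rightarrow> real \<Rightarrow> bool" where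
  "curvature_bound V adj K \<longleftrightarrow> (\<forall>f. \<forall>x\<in>V. gamma2 V adj f x \<ge> K * gamma V adj f f x)"

text \<open>The maximum is taken over \<open>K\<close> real or \<open>-\<infinity>\<close>; the value \<open>-\<infinity>\<close> is always admissible.\<close>

definition Ric :: "'a set \<Rightarrow> ('a \<Rightarrow> 'a \<Rightarrow> bool) \<Rightarrow> ereal" where
  "Ric V adj = (GREATEST K. K = -\<infinity> \<or> (\<exists>k. K = ereal k \<and> curvature_bound V adj k))"

text \<open>The maximum in the definition exists as soon as some vertex has finitely many, but at
  least one, neighbours other than itself.\<close>

lemma Ric_is_maximum:
  assumes x: "x \<in> V" and fin: "finite (nbhd V adj x)" and y: "y \<in> nbhd V adj x" "y \<noteq> x"
  shows "Ric V adj = -\<infinity> \<or> (\<exists>k. Ric V adj = ereal k \<and> curvature_bound V adj k)" (is ?A)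
    and "curvature_bound V adj k \<Longrightarrow> ereal k \<le> Ric V adj"
proof -
  let ?P = "\<lambda>K. K = -\<infinity> \<or> (\<exists>k. K = ereal k \<and> curvature_bound V adj k)"
  have "?P (Ric V adj) \<and> (\<forall>k. curvature_bound V adj k \<longrightarrow> ereal k \<le> Ric V adj)"
  proof (cases "\<exists>k. curvature_bound V adj k")
    case False
    then have "Ric V adj = -\<infinity>"
      unfolding Ric_def by (intro Greatest_equality) auto
    then show ?thesis using False by simp
  next
    case True
    define A where "A = {k. curvature_bound V adj k}"
    define f where "f = (\<lambda>v. if v = x then 0 else 1 :: real)"
    have "0 < (f x - f y) * (f x - f y)" using y by (simp add: f_def)
    also have "\<dots> \<le> (\<Sum>v \<in> nbhd V adj x. (f x - f v) * (f x - f v))"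
      by (rule member_le_sum) (use y fin in auto)
    finally have pos: "0 < gamma V adj f f x" by (simp add: gamma_def)
    have "k \<le> gamma2 V adj f x / gamma V adj f f x" if "k \<in> A" for k
      using that x pos by (simp add: A_def curvature_bound_def pos_le_divide_eq)
    then have bdd: "bdd_above A" by (rule bdd_aboveI)
    have ne: "A \<noteq> {}" using True by (simp add: A_def)
    have max: "curvature_bound V adj (Sup A)"
      unfolding curvature_bound_def
    proof (intro allI ballI)
      fix g z assume z: "z \<in> V"
      have le: "k * gamma V adj g g z \<le> gamma2 V adj g z" if "k \<in> A" for k
        using that z by (simp add: A_def curvature_bound_def)
      have "0 \<le> gamma V adj g g z" by (simp add: gamma_def sum_nonneg)
      then consider "gamma V adj g g z = 0" | "0 < gamma V adj g g z" by linarith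
      then show "Sup A * gamma V adj g g z \<le> gamma2 V adj g z"
      proof cases
        case 1
        then show ?thesis using le ne by auto
      next
        case 2
        have "Sup A \<le> gamma2 V adj g z / gamma V adj g g z"
          by (rule cSup_least[OF ne]) (use le 2 in \<open>simp add: pos_le_divide_eq\<close>)
        then show ?thesis using 2 by (simp add: pos_le_divide_eq)
      qed
    qed
    have up: "k \<le> Sup A" if "curvature_bound V adj k" for k
      using that cSup_upper[OF _ bdd] by (simp add: A_def)
    have "Ric V adj = ereal (Sup A)"
      unfolding Ric_def
      by (rule Greatest_equality) (use max up in auto)
    then show ?thesis using max up by simp
  qed
  then show ?A "curvature_bound V adj k \<Longrightarrow> ereal k \<le> Ric V adj" by auto
qed


section \<open>Bruhat order\<close>

definition word_length :: "('a, 'b) monoid_scheme \<Rightarrow> 'a set \<Rightarrow> 'a \<Rightarrow> nat" where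
  "word_length W S w =
     (LEAST k. \<exists>ws. set ws \<subseteq> S \<and> length ws = k \<and> foldr (\<otimes>\<^bsub>W\<^esub>) ws \<one>\<^bsub>W\<^esub> = w)"

definition reflections :: "('a, 'b) monoid_scheme \<Rightarrow> 'a set \<Rightarrow> 'a set" where
  "reflections W S = {w \<otimes>\<^bsub>W\<^esub> s \<otimes>\<^bsub>W\<^esub> inv\<^bsub>W\<^esub> w | w s. w \<in> carrier W \<and> s \<in> S}"

definition bruhat_step :: "('a, 'b) monoid_scheme \<Rightarrow> 'a set \<Rightarrow> 'a \<Rightarrow> 'a \<Rightarrow> bool" where
  "bruhat_step W S u w \<longleftrightarrow> w \<in> carrier W \<and>
     (\<exists>t \<in> reflections W S. u = t \<otimes>\<^bsub>W\<^esub> w \<and> word_length W S u < word_length W S w)"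

definition bruhat_le :: "('a, 'b) monoid_scheme \<Rightarrow> 'a set \<Rightarrow> 'a \<Rightarrow> 'a \<Rightarrow> bool" where
  "bruhat_le W S = (bruhat_step W S)\<^sup>*\<^sup>*"

definition bruhat_less :: "('a, 'b) monoid_scheme \<Rightarrow> 'a set \<Rightarrow> 'a \<Rightarrow> 'a \<Rightarrow> bool" where
  "bruhat_less W S u w \<longleftrightarrow> bruhat_le W S u w \<and> u \<noteq> w"

definition bruhat_covers :: "('a, 'b) monoid_scheme \<Rightarrow> 'a set \<Rightarrow> 'a \<Rightarrow> 'a \<Rightarrow> bool" where
  "bruhat_covers W S w u \<longleftrightarrow> bruhat_less W S u w \<and>
     \<not> (\<exists>z \<in> carrier W. bruhat_less W S u z \<and> bruhat_less W S z w)"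

definition hasse_adj :: "('a, 'b) monoid_scheme \<Rightarrow> 'a set \<Rightarrow> 'a \<Rightarrow> 'a \<Rightarrow> bool" where
  "hasse_adj W S u w \<longleftrightarrow> bruhat_covers W S u w \<or> bruhat_covers W S w u"

definition Ric_H :: "('a, 'b) monoid_scheme \<Rightarrow> 'a set \<Rightarrow> ereal" where
  "Ric_H W S = Ric (carrier W) (hasse_adj W S)"


section \<open>Coxeter groups\<close>

text \<open>The Coxeter group with generators \<open>0, \<dots>, n - 1\<close> and Coxeter matrix \<open>m\<close>, i.e. the group with
  presentation \<open>\<langle>0, \<dots>, n - 1 | (i j)\<^bsup>m i j\<^esup> = 1\<rangle>\<close>, as the quotient of the monoid of words
  by the congruence generated by the relations. Since the relations with \<open>m i i = 1\<close> make each
  generator its own inverse, formal inverses of the generators are not needed. An entry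
  \<open>m i j = 0\<close> imposes no relation and so stands for \<open>\<infinity>\<close>.\<close>

inductive coxeter_cong :: "nat \<Rightarrow> (nat \<Rightarrow> nat \<Rightarrow> nat) \<Rightarrow> nat list \<Rightarrow> nat list \<Rightarrow> bool"
  for n :: nat and m :: "nat \<Rightarrow> nat \<Rightarrow> nat" where
  refl: "u \<in> lists {..<n} \<Longrightarrow> coxeter_cong n m u u"
| sym: "coxeter_cong n m u v \<Longrightarrow> coxeter_cong n m v u"
| trans: "coxeter_cong n m u v \<Longrightarrow> coxeter_cong n m v w \<Longrightarrow> coxeter_cong n m u w"
| rel: "u \<in> lists {..<n} \<Longrightarrow> v \<in> lists {..<n} \<Longrightarrow> i < n \<Longrightarrow> j < n \<Longrightarrow>
    coxeter_cong n m (u @ concat (replicate (m i j) [i, j]) @ v) (u @ v)"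

definition word_class :: "nat \<Rightarrow> (nat \<Rightarrow> nat \<Rightarrow> nat) \<Rightarrow> nat list \<Rightarrow> nat list set" where
  "word_class n m u = {v. coxeter_cong n m u v}"

definition coxeter_group :: "nat \<Rightarrow> (nat \<Rightarrow> nat \<Rightarrow> nat) \<Rightarrow> nat list set monoid" where
  "coxeter_group n m =
     \<lparr> carrier = word_class n m ` lists {..<n},
       mult = (\<lambda>X Y. \<Union>u\<in>X. \<Union>v\<in>Y. word_class n m (u @ v)),
       one = word_class n m [] \<rparr>"

definition coxeter_gens :: "nat \<Rightarrow> (nat \<Rightarrow> nat \<Rightarrow> nat) \<Rightarrow> nat list set set" where
  "coxeter_gens n m = (\<lambda>i. word_class n m [i]) ` {..<n}"

lemma coxeter_cong_lists:
  "coxeter_cong n m u v \<Longrightarrow> u \<in> lists {..<n} \<and> v \<in> lists {..<n}"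
  by (induction rule: coxeter_cong.induct) (auto simp: in_lists_conv_set)

lemma coxeter_cong_ctxt:
  assumes "coxeter_cong n m u v" "p \<in> lists {..<n}" "q \<in> lists {..<n}"
  shows "coxeter_cong n m (p @ u @ q) (p @ v @ q)"
  using assms
proof (induction rule: coxeter_cong.induct)
  case (refl u)
  then show ?case by (intro coxeter_cong.refl) simp
next
  case (sym u v)
  show ?case by (rule coxeter_cong.sym[OF sym.IH[OF sym.prems]])
next
  case (trans u v w)
  show ?case by (rule coxeter_cong.trans[OF trans.IH(1)[OF trans.prems] trans.IH(2)[OF trans.prems]])
next
  case (rel u v i j)
  then show ?case
    using coxeter_cong.rel[of "p @ u" n "v @ q" i j m] by simp
qed

lemma coxeter_cong_append:
  assumes "coxeter_cong n m u u'" "coxeter_cong n m v v'"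
  shows "coxeter_cong n m (u @ v) (u' @ v')"
proof (rule coxeter_cong.trans)
  show "coxeter_cong n m (u @ v) (u' @ v)"
    using coxeter_cong_ctxt[OF assms(1), of "[]" v] coxeter_cong_lists[OF assms(2)] by simp
  show "coxeter_cong n m (u' @ v) (u' @ v')"
    using coxeter_cong_ctxt[OF assms(2), of u' "[]"] coxeter_cong_lists[OF assms(1)] by simp
qed

lemma word_class_eq_iff:
  assumes "u \<in> lists {..<n}"
  shows "word_class n m u = word_class n m v \<longleftrightarrow> coxeter_cong n m u v"
proof
  assume "word_class n m u = word_class n m v"
  then have "u \<in> word_class n m v"
    using coxeter_cong.refl[OF assms] by (auto simp: word_class_def)
  then show "coxeter_cong n m u v"
    by (simp add: word_class_def coxeter_cong.sym)
next
  assume uv: "coxeter_cong n m u v"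
  have "coxeter_cong n m u w \<longleftrightarrow> coxeter_cong n m v w" for w
    using coxeter_cong.trans[OF uv, of w] coxeter_cong.trans[OF coxeter_cong.sym[OF uv], of w]
    by (rule iffI[rotated])
  then show "word_class n m u = word_class n m v"
    by (simp add: word_class_def)
qed

lemma coxeter_group_mult:
  assumes "u \<in> lists {..<n}" "v \<in> lists {..<n}"
  shows "word_class n m u \<otimes>\<^bsub>coxeter_group n m\<^esub> word_class n m v = word_class n m (u @ v)"
proof -
  have eq: "word_class n m (u' @ v') = word_class n m (u @ v)"
    if "u' \<in> word_class n m u" "v' \<in> word_class n m v" for u' v'
    using that assms coxeter_cong_append[of n m u u' v v'] word_class_eq_iff[of "u @ v" n m "u' @ v'"]
    by (simp add: word_class_def)
  have mem: "u \<in> word_class n m u" "v \<in> word_class n m v"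
    using assms by (auto simp: word_class_def intro: coxeter_cong.refl)
  have "(\<Union>u'\<in>word_class n m u. \<Union>v'\<in>word_class n m v. word_class n m (u' @ v'))
      = (\<Union>u'\<in>word_class n m u. \<Union>v'\<in>word_class n m v. word_class n m (u @ v))"
    by (simp add: eq cong: SUP_cong)
  also have "\<dots> = word_class n m (u @ v)" using mem by blast
  finally show ?thesis by (simp add: coxeter_group_def)
qed

lemma group_coxeter_group:
  assumes "\<And>i. i < n \<Longrightarrow> m i i = 1"
  shows "group (coxeter_group n m)"
proof (rule groupI)
  have rev: "coxeter_cong n m (rev u @ u) []" if "u \<in> lists {..<n}" for u
    using that
  proof (induction u)
    case Nil
    show ?case by (auto intro: coxeter_cong.refl)
  next
    case (Cons i u)
    then have "coxeter_cong n m (rev u @ [i, i] @ u) (rev u @ u)"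
      using coxeter_cong.rel[of "rev u" n u i i m] assms[of i]
      by (simp add: in_lists_conv_set)
    from coxeter_cong.trans[OF this] show ?case using Cons by simp
  qed
  fix x assume "x \<in> carrier (coxeter_group n m)"
  then obtain u where u: "x = word_class n m u" "u \<in> lists {..<n}"
    by (auto simp: coxeter_group_def)
  have r: "rev u \<in> lists {..<n}" using u by (simp add: in_lists_conv_set)
  have "word_class n m (rev u @ u) = word_class n m []"
    using word_class_eq_iff rev[OF u(2)] u(2) r by simp
  then have "word_class n m (rev u) \<otimes>\<^bsub>coxeter_group n m\<^esub> x = \<one>\<^bsub>coxeter_group n m\<^esub>"
    using u(1) coxeter_group_mult[OF r u(2)] by (simp add: coxeter_group_def)
  then show "\<exists>y\<in>carrier (coxeter_group n m). y \<otimes>\<^bsub>coxeter_group n m\<^esub> x = \<one>\<^bsub>coxeter_group n m\<^esub>"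
    using r by (auto simp: coxeter_group_def)
next
  have one: "\<one>\<^bsub>coxeter_group n m\<^esub> = word_class n m []"
    and car: "carrier (coxeter_group n m) = word_class n m ` lists {..<n}"
    by (simp_all add: coxeter_group_def)
  show "\<one>\<^bsub>coxeter_group n m\<^esub> \<in> carrier (coxeter_group n m)"
    by (auto simp: one car)
  fix x assume x: "x \<in> carrier (coxeter_group n m)"
  then show "\<one>\<^bsub>coxeter_group n m\<^esub> \<otimes>\<^bsub>coxeter_group n m\<^esub> x = x"
    using coxeter_group_mult[of "[]" n _ m] by (auto simp: one car)
  obtain u where u: "x = word_class n m u" "u \<in> lists {..<n}" using x by (auto simp: car)
  fix y assume "y \<in> carrier (coxeter_group n m)"
  then obtain v where v: "y = word_class n m v" "v \<in> lists {..<n}" by (auto simp: car)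
  have uv: "u @ v \<in> lists {..<n}" using u v by simp
  show "x \<otimes>\<^bsub>coxeter_group n m\<^esub> y \<in> carrier (coxeter_group n m)"
    unfolding car u(1) v(1) coxeter_group_mult[OF u(2) v(2)] using uv by (rule imageI)
  fix z assume "z \<in> carrier (coxeter_group n m)"
  then obtain w where w: "z = word_class n m w" "w \<in> lists {..<n}" by (auto simp: car)
  have vw: "v @ w \<in> lists {..<n}" using v w by simp
  show "x \<otimes>\<^bsub>coxeter_group n m\<^esub> y \<otimes>\<^bsub>coxeter_group n m\<^esub> z
      = x \<otimes>\<^bsub>coxeter_group n m\<^esub> (y \<otimes>\<^bsub>coxeter_group n m\<^esub> z)"
    unfolding u(1) v(1) w(1) coxeter_group_mult[OF u(2) v(2)] coxeter_group_mult[OF v(2) w(2)]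
      coxeter_group_mult[OF uv w(2)] coxeter_group_mult[OF u(2) vw] by simp
qed

text \<open>A Coxeter diagram is a finite map from edges \<open>{i, j}\<close> to their labels.\<close>

definition coxeter_matrix :: "(nat set \<rightharpoonup> nat) \<Rightarrow> nat \<Rightarrow> nat \<Rightarrow> nat" where
  "coxeter_matrix D i j =
     (if i = j then 1 else case D {i, j} of None \<Rightarrow> 2 | Some k \<Rightarrow> k)"

text \<open>\<open>0 -- 1 =4= 2 -- 3\<close>\<close>

definition F4_matrix :: "nat \<Rightarrow> nat \<Rightarrow> nat" where
  "F4_matrix = coxeter_matrix [{0, 1} \<mapsto> 3, {1, 2} \<mapsto> 4, {2, 3} \<mapsto> 3]"

text \<open>The path \<open>0 -- 1 -- 2 -- 3 -- 4\<close> with the sixth node \<open>5\<close> attached to its midpoint \<open>2\<close>\<close>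

definition E6_matrix :: "nat \<Rightarrow> nat \<Rightarrow> nat" where
  "E6_matrix =
     coxeter_matrix [{0, 1} \<mapsto> 3, {1, 2} \<mapsto> 3, {2, 3} \<mapsto> 3, {3, 4} \<mapsto> 3, {2, 5} \<mapsto> 3]"

text \<open>\<open>0 =5= 1 -- 2\<close>\<close>

definition H3_matrix :: "nat \<Rightarrow> nat \<Rightarrow> nat" where
  "H3_matrix = coxeter_matrix [{0, 1} \<mapsto> 5, {1, 2} \<mapsto> 3]"

end

theory Submission
  imports Defs
begin

text \<open>
  Two elementary facts give the bounds. If all degrees of a graph are at most \<open>D\<close>, then its
  curvature is at least \<open>2 - D\<close> (\<open>curvature_bound_degree\<close>): up to nonnegative squares,
  \<open>\<Gamma>\<^sub>2(f)(x)\<close> is a combination of the \<open>(f v - f x)\<^sup>2\<close> over the neighbours \<open>v\<close> of \<open>x\<close>, and the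
  coefficient of each of them involves only the degrees of \<open>v\<close> and \<open>x\<close>. On the other hand, two
  elements joined in the Hasse diagram of the Bruhat order differ by left multiplication with a
  reflection, so every degree is at most the number of reflections. Hence
  \<open>Ric(H(W)) \<ge> 2 - card T\<close> (\<open>Ric_H_ge_card_reflections\<close>). The groups \<open>F\<^sub>4\<close>, \<open>E\<^sub>6\<close> and \<open>H\<^sub>3\<close> have
  24, 36 and 15 reflections, which gives the lower bounds -22, -34 and -13, stronger than the
  stated ones.

  What remains is to show that a group given by generators and relations has no more than the
  expected number of reflections. For this the relations must be shown to force enough
  identities between conjugates of generators; mapping the group to a concrete reflection group
  would only bound the number from below. The proof is a coset enumeration in the style of Todd
  and Coxeter, for the action of the group on its reflections by conjugation. A table records how
  the simple reflections permute the positive roots up to sign. Each root is given a palindromic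
  word by climbing from a simple root along a spanning forest of the table. An edge of the table
  says that conjugating the word of one root by a generator gives, in the group, the word of
  another. The edges outside the forest are established one after the other: an edge holds if it
  closes a cycle labelled by a relator whose other edges are known to hold, or if it lies in a
  rank two subsystem and itself spells out a relator. Since every reflection is reached from a
  generator by conjugations with generators, the words of the roots exhaust the reflections
  (\<open>reflections_subset_root_words\<close>). For the three groups the conditions are checked by
  computation.
\<close>

section \<open>A lower bound for the curvature in terms of the degree\<close>

text \<open>Put \<open>g v = f v - f x\<close>. Expanding the definitions gives
  \<open>4 \<Gamma>\<^sub>2(f)(x) = (\<Sum>\<^sub>v \<Sum>\<^sub>u (f u - f v)\<^sup>2 - 2 g(v) (f u - f v)) - deg x (\<Sum>\<^sub>v g(v)\<^sup>2) + 2 (\<Sum>\<^sub>v g v)\<^sup>2\<close>,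
  where \<open>v\<close> runs over the neighbours of \<open>x\<close> and \<open>u\<close> over those of \<open>v\<close>. Completing the square, each
  inner summand is at least \<open>- g(v)\<^sup>2\<close>, and the one with \<open>u = x\<close> equals \<open>3 g(v)\<^sup>2\<close>. So \<open>g(v)\<^sup>2\<close> occurs
  with coefficient at least \<open>4 - deg v - deg x\<close>.\<close>

lemma curvature_bound_degree:
  fixes adj :: "'a \<Rightarrow> 'a \<Rightarrow> bool"
  assumes fin: "\<And>x. x \<in> V \<Longrightarrow> finite (nbhd V adj x)"
    and deg: "\<And>x. x \<in> V \<Longrightarrow> card (nbhd V adj x) \<le> D"
    and sym: "\<And>x y. adj x y \<Longrightarrow> adj y x"
  shows "curvature_bound V adj (2 - real D)"
  unfolding curvature_bound_def
proof (intro allI ballI)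
  fix f :: "'a \<Rightarrow> real" and x assume x: "x \<in> V"
  define N where "N = nbhd V adj"
  define g where "g v = f v - f x" for v
  have finN: "finite (N y)" and degN: "real (card (N y)) \<le> real D" if "y \<in> V" for y
    using fin[OF that] deg[OF that] by (simp_all add: N_def)
  have local_bound:
    "(\<Sum>u\<in>N v. (f u - f v)^2 - 2 * g v * (f u - f v)) \<ge> (4 - real D) * (g v)^2"
    if v: "v \<in> N x" for v
  proof -
    have vV: "v \<in> V" and xv: "x \<in> N v"
      using v x sym by (auto simp: N_def nbhd_def)
    have "(\<Sum>u\<in>N v. (f u - f v)^2 - 2 * g v * (f u - f v))
        = (\<Sum>u\<in>N v. (f u - f v - g v)^2 - (g v)^2)"
      by (intro sum.cong) (auto simp: power2_eq_square algebra_simps)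
    also have "\<dots> = (\<Sum>u\<in>N v. (f u - f v - g v)^2) - card (N v) * (g v)^2"
      by (simp add: sum_subtractf)
    \<comment> \<open>Of the completed squares only the one at \<open>u = x\<close> is kept.\<close>
    also have "(\<Sum>u\<in>N v. (f u - f v - g v)^2) \<ge> (f x - f v - g v)^2"
      by (rule member_le_sum) (use xv finN[OF vV] in auto)
    moreover have "(f x - f v - g v)^2 = 4 * (g v)^2"
      by (simp add: g_def power2_eq_square algebra_simps)
    moreover have "card (N v) * (g v)^2 \<le> real D * (g v)^2"
      using degN[OF vV] by (intro mult_right_mono) auto
    ultimately show ?thesis by (simp add: algebra_simps)
  qed
  define Q where "Q = (\<Sum>v\<in>N x. (g v)^2)"
  have gam: "gamma V adj f f y = 1/2 * (\<Sum>u\<in>N y. (f u - f y)^2)" for y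
    by (simp add: gamma_def N_def power2_eq_square algebra_simps)
  have gx: "gamma V adj f f x = Q / 2" by (simp add: gam Q_def g_def)
  have "gamma2 V adj f x
      = 1/2 * (\<Sum>v\<in>N x. gamma V adj f f v - Q / 2)
        - 1/2 * (\<Sum>v\<in>N x. g v * (laplacian V adj f v - laplacian V adj f x))"
    unfolding gamma2_def laplacian_def[of V adj "gamma V adj f f"]
      gamma_def[of V adj f "laplacian V adj f"]
    by (simp add: gx g_def algebra_simps flip: N_def)
  also have "\<dots> = 1/4 * (\<Sum>v\<in>N x. (\<Sum>u\<in>N v. (f u - f v)^2 - 2 * g v * (f u - f v)))
      - card (N x) * Q / 4 + 1/2 * (\<Sum>v\<in>N x. g v)^2"
  proof -
    have "(\<Sum>v\<in>N x. g v * (laplacian V adj f v - laplacian V adj f x))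
        = (\<Sum>v\<in>N x. \<Sum>u\<in>N v. g v * (f u - f v)) - (\<Sum>v\<in>N x. g v)^2"
    proof -
      have "laplacian V adj f x = (\<Sum>v\<in>N x. g v)" by (simp add: laplacian_def g_def N_def)
      moreover have "g v * laplacian V adj f v = (\<Sum>u\<in>N v. g v * (f u - f v))" for v
        unfolding laplacian_def N_def by (rule sum_distrib_left)
      ultimately show ?thesis
        by (simp add: right_diff_distrib sum_subtractf power2_eq_square flip: sum_distrib_right)
    qed
    moreover have "(\<Sum>v\<in>N x. gamma V adj f f v - Q / 2)
        = 1/2 * (\<Sum>v\<in>N x. \<Sum>u\<in>N v. (f u - f v)^2) - card (N x) * Q / 2"
      by (simp add: gam sum_subtractf sum_distrib_left)
    moreover have "(\<Sum>v\<in>N x. \<Sum>u\<in>N v. (f u - f v)^2 - 2 * g v * (f u - f v))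
        = (\<Sum>v\<in>N x. \<Sum>u\<in>N v. (f u - f v)^2) - 2 * (\<Sum>v\<in>N x. \<Sum>u\<in>N v. g v * (f u - f v))"
      by (simp add: sum_subtractf sum_distrib_left mult.assoc)
    ultimately show ?thesis by (simp add: algebra_simps)
  qed
  also have "\<dots> \<ge> 1/4 * ((4 - real D) * Q) - real D * Q / 4"
  proof -
    have "(\<Sum>v\<in>N x. (\<Sum>u\<in>N v. (f u - f v)^2 - 2 * g v * (f u - f v))) \<ge> (4 - real D) * Q"
      unfolding Q_def sum_distrib_left by (intro sum_mono local_bound)
    moreover have "card (N x) * Q \<le> real D * Q"
      using degN[OF x] by (intro mult_right_mono) (auto simp: Q_def intro: sum_nonneg)
    moreover have "1/4 * ((4 - real D) * Q) - real D * Q / 4 \<le> 1/4 * L - c / 4 + 1/2 * S^2"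
      if "(4 - real D) * Q \<le> L" "c \<le> real D * Q" for L c S :: real
    proof -
      have "(4 - real D) * Q = 4 * Q - real D * Q" by (simp add: left_diff_distrib)
      then show ?thesis using that zero_le_power2[of S] by linarith
    qed
    ultimately show ?thesis by blast
  qed
  finally show "(2 - real D) * gamma V adj f f x \<le> gamma2 V adj f x"
    by (simp add: gx field_simps)
qed


section \<open>Degrees in the Hasse diagram of the Bruhat order\<close>

lemma bruhat_le_cases:
  assumes "bruhat_le W S u w"
  shows "u = w \<or> word_length W S u < word_length W S w"
proof -
  have "(bruhat_step W S)\<^sup>*\<^sup>* u w" using assms by (simp add: bruhat_le_def)
  then show ?thesis
    by (induction rule: rtranclp_induct) (auto simp: bruhat_step_def)
qed

text \<open>A chain of Bruhat steps realising a covering relation cannot pass through a third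
  element, so it is a single step, which by definition is multiplication by a reflection.\<close>

lemma bruhat_covers_reflection:
  assumes cov: "bruhat_covers W S w u" and u: "u \<in> carrier W"
  shows "w \<in> carrier W \<and> (\<exists>t\<in>reflections W S. u = t \<otimes>\<^bsub>W\<^esub> w)"
proof -
  have "(bruhat_step W S)\<^sup>*\<^sup>* u w" "u \<noteq> w"
    using cov by (auto simp: bruhat_covers_def bruhat_less_def bruhat_le_def)
  then obtain z where z: "(bruhat_step W S)\<^sup>*\<^sup>* u z" and zw: "bruhat_step W S z w"
    by (auto elim: rtranclp.cases)
  have "z = u"
  proof (rule ccontr)
    assume "z \<noteq> u"
    have "z \<in> carrier W"
      using z \<open>z \<noteq> u\<close> by (auto elim: rtranclp.cases simp: bruhat_step_def)
    moreover have "bruhat_less W S u z" "bruhat_less W S z w"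
      using z zw r_into_rtranclp[of "bruhat_step W S", OF zw] \<open>z \<noteq> u\<close>
      by (metis bruhat_le_def bruhat_less_def, metis bruhat_le_def bruhat_less_def bruhat_step_def less_irrefl)
    ultimately show False using cov by (auto simp: bruhat_covers_def)
  qed
  then show ?thesis using zw by (auto simp: bruhat_step_def)
qed

text \<open>A neighbour \<open>y\<close> of \<open>x\<close> below it is \<open>t x\<close> for a reflection \<open>t\<close> at once; if it lies above, then
  \<open>x = t y\<close>, and \<open>y = t x\<close> because reflections are involutions.\<close>

lemma hasse_nbhd_subset:
  assumes "group W" and S: "S \<subseteq> carrier W" and inv2: "\<And>s. s \<in> S \<Longrightarrow> s \<otimes>\<^bsub>W\<^esub> s = \<one>\<^bsub>W\<^esub>"
    and x: "x \<in> carrier W"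
  shows "nbhd (carrier W) (hasse_adj W S) x \<subseteq> (\<lambda>t. t \<otimes>\<^bsub>W\<^esub> x) ` reflections W S"
proof
  interpret group W by fact
  have involution: "t \<in> carrier W \<and> t \<otimes>\<^bsub>W\<^esub> t = \<one>\<^bsub>W\<^esub>" if "t \<in> reflections W S" for t
  proof -
    obtain w s where t: "t = w \<otimes>\<^bsub>W\<^esub> s \<otimes>\<^bsub>W\<^esub> inv\<^bsub>W\<^esub> w" "w \<in> carrier W" "s \<in> S"
      using \<open>t \<in> reflections W S\<close> by (auto simp: reflections_def)
    have s: "s \<in> carrier W" using t S by auto
    have "inv\<^bsub>W\<^esub> w \<otimes>\<^bsub>W\<^esub> (w \<otimes>\<^bsub>W\<^esub> y) = y" "s \<otimes>\<^bsub>W\<^esub> (s \<otimes>\<^bsub>W\<^esub> y) = y"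
      if "y \<in> carrier W" for y
      using that t s inv2 by (simp_all flip: m_assoc)
    then have "t \<otimes>\<^bsub>W\<^esub> t = \<one>\<^bsub>W\<^esub>"
      unfolding t(1) using t s by (simp add: m_assoc)
    then show ?thesis using t s by simp
  qed
  fix y assume "y \<in> nbhd (carrier W) (hasse_adj W S) x"
  then have y: "y \<in> carrier W" and "bruhat_covers W S x y \<or> bruhat_covers W S y x"
    by (auto simp: nbhd_def hasse_adj_def)
  then obtain t where "t \<in> reflections W S" "y = t \<otimes>\<^bsub>W\<^esub> x \<or> x = t \<otimes>\<^bsub>W\<^esub> y"
    using bruhat_covers_reflection x by metis
  moreover have "t \<otimes>\<^bsub>W\<^esub> (t \<otimes>\<^bsub>W\<^esub> y) = y"
    using involution[OF \<open>t \<in> reflections W S\<close>] y by (simp flip: m_assoc)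
  ultimately show "y \<in> (\<lambda>t. t \<otimes>\<^bsub>W\<^esub> x) ` reflections W S"
    by (metis image_eqI)
qed

text \<open>The maximum defining the curvature exists only if some vertex has a neighbour other than
  itself. The identity and a generator provide such a pair: lengths increase strictly along the
  Bruhat order, and no length lies strictly between 0 and 1.\<close>

lemma hasse_adj_one_generator:
  assumes "group W" and S: "S \<subseteq> carrier W" and inv2: "\<And>s. s \<in> S \<Longrightarrow> s \<otimes>\<^bsub>W\<^esub> s = \<one>\<^bsub>W\<^esub>"
    and s: "s \<in> S" and ne: "s \<noteq> \<one>\<^bsub>W\<^esub>"
  shows "hasse_adj W S \<one>\<^bsub>W\<^esub> s"
proof -
  interpret group W by fact
  have sc: "s \<in> carrier W" using s S by auto
  have one: "word_length W S \<one>\<^bsub>W\<^esub> = 0"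
    unfolding word_length_def by (rule Least_eq_0) simp
  let ?P = "\<lambda>k. \<exists>ws. set ws \<subseteq> S \<and> length ws = k \<and> foldr (\<otimes>\<^bsub>W\<^esub>) ws \<one>\<^bsub>W\<^esub> = s"
  have P1: "?P 1" by (rule exI[of _ "[s]"]) (use s sc in simp)
  have le: "word_length W S s \<le> 1" unfolding word_length_def by (rule Least_le[of ?P, OF P1])
  have "?P (word_length W S s)" unfolding word_length_def by (rule LeastI[of ?P, OF P1])
  then have pos: "word_length W S s \<noteq> 0" using ne by (metis foldr.simps(1) id_apply length_0_conv)
  have "s \<in> reflections W S"
    unfolding reflections_def using s sc by (intro CollectI exI[of _ "\<one>\<^bsub>W\<^esub>"] exI[of _ s]) simp
  then have "bruhat_step W S \<one>\<^bsub>W\<^esub> s"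
    unfolding bruhat_step_def using sc inv2[OF s] one pos by (auto intro!: bexI[of _ s])
  then have "bruhat_less W S \<one>\<^bsub>W\<^esub> s" using ne by (auto simp: bruhat_less_def bruhat_le_def)
  moreover have "\<not> (bruhat_less W S \<one>\<^bsub>W\<^esub> z \<and> bruhat_less W S z s)" for z
    using le one bruhat_le_cases[of W S "\<one>\<^bsub>W\<^esub>" z] bruhat_le_cases[of W S z s]
    by (auto simp: bruhat_less_def)
  ultimately show ?thesis by (simp add: hasse_adj_def bruhat_covers_def)
qed

theorem Ric_H_ge_card_reflections:
  assumes "group W" and S: "S \<subseteq> carrier W" and inv2: "\<And>s. s \<in> S \<Longrightarrow> s \<otimes>\<^bsub>W\<^esub> s = \<one>\<^bsub>W\<^esub>"
    and s: "s \<in> S" "s \<noteq> \<one>\<^bsub>W\<^esub>" and fin: "finite (reflections W S)"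
  shows "Ric_H W S \<ge> ereal (2 - real (card (reflections W S)))"
proof -
  interpret group W by fact
  have sub: "nbhd (carrier W) (hasse_adj W S) x \<subseteq> (\<lambda>t. t \<otimes>\<^bsub>W\<^esub> x) ` reflections W S"
    if "x \<in> carrier W" for x
    using hasse_nbhd_subset[OF \<open>group W\<close> S inv2 that] .
  have fin_nbhd: "finite (nbhd (carrier W) (hasse_adj W S) x)" if "x \<in> carrier W" for x
    using finite_subset[OF sub[OF that]] fin by blast
  have "card (nbhd (carrier W) (hasse_adj W S) x) \<le> card (reflections W S)"
    if "x \<in> carrier W" for x
    using card_mono[OF _ sub[OF that]] card_image_le[OF fin, of "\<lambda>t. t \<otimes>\<^bsub>W\<^esub> x"] fin
    by (meson finite_imageI le_trans)
  then have "curvature_bound (carrier W) (hasse_adj W S) (2 - real (card (reflections W S)))"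
    by (intro curvature_bound_degree fin_nbhd) (auto simp: hasse_adj_def)
  moreover have "s \<in> nbhd (carrier W) (hasse_adj W S) \<one>\<^bsub>W\<^esub>"
    using hasse_adj_one_generator[OF \<open>group W\<close> S inv2 s] S s by (auto simp: nbhd_def)
  ultimately show ?thesis
    unfolding Ric_H_def using Ric_is_maximum(2)[OF _ fin_nbhd] s by blast
qed


section \<open>Reflections of a Coxeter group as words\<close>

text \<open>All relators have even length, so the parity of a word is an invariant of its class. This
  is what shows that a generator is not the identity.\<close>

lemma coxeter_cong_parity: "coxeter_cong n m u v \<Longrightarrow> even (length u) = even (length v)"
  by (induction rule: coxeter_cong.induct) (auto simp: length_concat sum_list_replicate)

lemma coxeter_generators:
  assumes diag: "\<forall>i<n. m i i = 1" and n: "0 < n"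
  shows "coxeter_gens n m \<subseteq> carrier (coxeter_group n m)"
    and "\<And>s. s \<in> coxeter_gens n m \<Longrightarrow> s \<otimes>\<^bsub>coxeter_group n m\<^esub> s = \<one>\<^bsub>coxeter_group n m\<^esub>"
    and "\<exists>s\<in>coxeter_gens n m. s \<noteq> \<one>\<^bsub>coxeter_group n m\<^esub>"
proof -
  show "coxeter_gens n m \<subseteq> carrier (coxeter_group n m)"
    by (auto simp: coxeter_gens_def coxeter_group_def)
  have "coxeter_cong n m [i, i] []" if "i < n" for i
    using coxeter_cong.rel[of "[]" n "[]" i i m] that diag by simp
  then have "word_class n m [i, i] = word_class n m []" if "i < n" for i
    using that word_class_eq_iff[of "[i, i]" n m "[]"] by simp
  then show "s \<otimes>\<^bsub>coxeter_group n m\<^esub> s = \<one>\<^bsub>coxeter_group n m\<^esub>" if "s \<in> coxeter_gens n m" for s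
  proof -
    obtain i where i: "i < n" "s = word_class n m [i]" using \<open>s \<in> coxeter_gens n m\<close>
      by (auto simp: coxeter_gens_def)
    then have "s \<otimes>\<^bsub>coxeter_group n m\<^esub> s = word_class n m [i, i]"
      using coxeter_group_mult[of "[i]" n "[i]" m] by simp
    then show ?thesis
      using i \<open>\<And>i. i < n \<Longrightarrow> word_class n m [i, i] = word_class n m []\<close> by (simp add: coxeter_group_def)
  qed
  have "word_class n m [0] \<noteq> word_class n m []"
    using word_class_eq_iff[of "[0]" n m "[]"] coxeter_cong_parity[of n m "[0]" "[]"] n by auto
  then show "\<exists>s\<in>coxeter_gens n m. s \<noteq> \<one>\<^bsub>coxeter_group n m\<^esub>"
    using n by (auto simp: coxeter_gens_def coxeter_group_def)
qed

lemma coxeter_cong_cancel: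
  assumes "u \<in> lists {..<n}" "v \<in> lists {..<n}" "i < n" "m i i = 1"
  shows "coxeter_cong n m (u @ [i, i] @ v) (u @ v)"
  using coxeter_cong.rel[OF assms(1-3,3), of m] assms(4) by simp

lemma coxeter_cong_rev_cancel:
  assumes u: "u \<in> lists {..<n}" and diag: "\<forall>i<n. m i i = 1"
  shows "coxeter_cong n m (u @ rev u) []" and "coxeter_cong n m (rev u @ u) []"
proof -
  have *: "coxeter_cong n m (u @ rev u) []" if "u \<in> lists {..<n}" for u
    using that
  proof (induction u rule: rev_induct)
    case Nil
    show ?case by (auto intro: coxeter_cong.refl)
  next
    case (snoc i u)
    then have "coxeter_cong n m (u @ [i, i] @ rev u) (u @ rev u)"
      by (intro coxeter_cong_cancel) (auto simp: in_lists_conv_set diag)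
    from coxeter_cong.trans[OF this] show ?case using snoc by simp
  qed
  show "coxeter_cong n m (u @ rev u) []" using *[OF u] .
  show "coxeter_cong n m (rev u @ u) []" using *[of "rev u"] u by (simp add: in_lists_conv_set)
qed

lemma reflections_coxeter_group:
  assumes diag: "\<forall>i<n. m i i = 1"
  shows "reflections (coxeter_group n m) (coxeter_gens n m)
    = {word_class n m (u @ [i] @ rev u) | u i. u \<in> lists {..<n} \<and> i < n}"
proof -
  let ?W = "coxeter_group n m"
  interpret group ?W by (rule group_coxeter_group) (use diag in simp)
  have conj: "word_class n m u \<otimes>\<^bsub>?W\<^esub> word_class n m [i] \<otimes>\<^bsub>?W\<^esub> inv\<^bsub>?W\<^esub> (word_class n m u)
      = word_class n m (u @ [i] @ rev u)" if u: "u \<in> lists {..<n}" and i: "i < n" for u i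
  proof -
    have ru: "rev u \<in> lists {..<n}" and ui: "u @ [i] \<in> lists {..<n}"
      using u i by (auto simp: in_lists_conv_set)
    have "word_class n m (rev u @ u) = word_class n m []"
      using word_class_eq_iff coxeter_cong_rev_cancel(2)[where m = m, OF u diag] u ru by simp
    then have "word_class n m (rev u) \<otimes>\<^bsub>?W\<^esub> word_class n m u = \<one>\<^bsub>?W\<^esub>"
      using coxeter_group_mult[OF ru u, of m] by (simp add: coxeter_group_def)
    then have "inv\<^bsub>?W\<^esub> (word_class n m u) = word_class n m (rev u)"
      using u ru by (intro inv_equality) (auto simp: coxeter_group_def)
    then show ?thesis
      using coxeter_group_mult[OF u, of "[i]" m] coxeter_group_mult[OF ui ru, of m] i by simp
  qed
  have car: "carrier ?W = word_class n m ` lists {..<n}" by (simp add: coxeter_group_def)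
  show ?thesis
    unfolding reflections_def car coxeter_gens_def
    by (auto simp: conj) (metis conj image_eqI lessThan_iff append_Cons append_Nil in_listsI)+
qed


section \<open>Counting reflections by a table of roots\<close>

text \<open>A table \<open>T\<close> lists, in row \<open>k\<close> and column \<open>s\<close>, the index of the positive root to which the
  reflection in the simple root \<open>s\<close> takes root \<open>k\<close>, up to sign. The simple roots come first, with
  index equal to their generator, and the others are numbered by increasing depth, i.e. by the
  number of simple reflections that it takes to reach them from a simple root. Such a table
  serves as a certificate: \<open>root_table\<close> states what is checked about it, without mention of roots.\<close>

text \<open>A word for the reflection in root \<open>k\<close>: as long as some generator leads to a root with a
  smaller index, conjugate by the first one that does. These choices form a spanning forest of
  the table, rooted at the simple roots, and the first letter of the word of a root \<open>k\<close> that is not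
  simple is the label of the edge from \<open>k\<close> towards the simple root of its tree.\<close>

function root_word :: "nat list list \<Rightarrow> nat \<Rightarrow> nat list" where
  "root_word T k = (case find (\<lambda>s. T ! k ! s < k) [0..<length (T ! k)] of
     None \<Rightarrow> [k]
   | Some s \<Rightarrow> s # root_word T (T ! k ! s) @ [s])"
  by pat_completeness auto
termination
  by (relation "Wellfounded.measure snd") (auto simp: find_Some_iff)

declare root_word.simps [simp del]

definition root_edge :: "nat \<Rightarrow> (nat \<Rightarrow> nat \<Rightarrow> nat) \<Rightarrow> nat list list \<Rightarrow> nat \<Rightarrow> nat \<Rightarrow> bool" where
  "root_edge n m T k s \<longleftrightarrow>
     coxeter_cong n m ([s] @ root_word T k @ [s]) (root_word T (T ! k ! s))"

fun follow :: "nat list list \<Rightarrow> (nat \<Rightarrow> nat \<Rightarrow> bool) \<Rightarrow> nat \<Rightarrow> nat list \<Rightarrow> nat option" where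
  "follow T E p [] = Some p"
| "follow T E p (x # xs) = (if E p x then follow T E (T ! p ! x) xs else None)"

text \<open>The edges that may be used when an edge at \<open>k\<close> is established: those between roots with a
  smaller index, and the tree edge below \<open>k\<close> in both directions. For a simple root \<open>k\<close> the latter
  is the loop labelled \<open>k\<close>.\<close>

definition earlier_edge :: "nat list list \<Rightarrow> nat \<Rightarrow> nat \<Rightarrow> nat \<Rightarrow> bool" where
  "earlier_edge T k p x \<longleftrightarrow> p < k \<and> T ! p ! x < k \<or>
     x = hd (root_word T k) \<and> (p = k \<or> p < k \<and> T ! p ! x = k)"

text \<open>Three reasons for which the edge labelled \<open>s\<close> at \<open>k\<close> holds, with \<open>a\<close> the first letter of the
  word of \<open>k\<close>. It may be the tree edge itself. It may lie in the rank two subsystem spanned by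
  the simple roots \<open>s\<close> and \<open>a\<close>; then the words of both ends alternate between \<open>s\<close> and \<open>a\<close>, and the
  claimed identity is literally the relator \<open>(s a)\<close> to the power \<open>m s a\<close>. In all other cases, that
  relator says that conjugation by \<open>s\<close> agrees with conjugation by \<open>a s a \<dots> a\<close> with
  \<open>2 m a s - 1\<close> letters, and the latter can be computed by walking around the orbit of \<open>k\<close> under the
  two reflections along edges that are known already: if neither \<open>s\<close> nor \<open>a\<close> increases the depth
  of \<open>k\<close>, then \<open>k\<close> is the deepest root of that orbit, and the walk meets it by its tree edge only.\<close>

definition edge_ok :: "(nat \<Rightarrow> nat \<Rightarrow> nat) \<Rightarrow> nat list list \<Rightarrow> nat \<Rightarrow> nat \<Rightarrow> bool" where
  "edge_ok m T k s \<longleftrightarrow> (let a = hd (root_word T k) in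
     s = a \<or>
     [s] @ root_word T k @ [s] @ rev (root_word T (T ! k ! s)) = concat (replicate (m s a) [s, a]) \<or>
     0 < m a s \<and>
     follow T (earlier_edge T k) k (concat (replicate (m a s - 1) [a, s]) @ [a]) = Some (T ! k ! s))"

definition root_table :: "nat \<Rightarrow> (nat \<Rightarrow> nat \<Rightarrow> nat) \<Rightarrow> nat list list \<Rightarrow> bool" where
  "root_table n m T \<longleftrightarrow>
     n \<le> length T \<and>
     (\<forall>k\<in>set [0..<n]. root_word T k = [k]) \<and>
     (\<forall>k\<in>set [0..<length T].
        length (T ! k) = n \<and> list_all (\<lambda>s. s < n) (root_word T k) \<and>
        T ! k ! hd (root_word T k) \<le> k \<and>
        (\<forall>s\<in>set [0..<n].
           T ! k ! s < length T \<and> T ! (T ! k ! s) ! s = k \<and>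
           (T ! k ! s \<le> k \<longrightarrow> edge_ok m T k s)))"

lemma root_word_not_Nil: "root_word T k \<noteq> []"
  by (subst root_word.simps) (auto split: option.split)

lemma follow_conj:
  assumes "follow T E p xs = Some q" and "xs \<in> lists {..<n}"
    and "\<And>p x. E p x \<Longrightarrow> x < n \<Longrightarrow> root_edge n m T p x"
    and "root_word T p \<in> lists {..<n}"
  shows "coxeter_cong n m (rev xs @ root_word T p @ xs) (root_word T q)"
  using assms
proof (induction xs arbitrary: p)
  case Nil
  then show ?case by (auto intro: coxeter_cong.refl)
next
  case (Cons x xs)
  then have E: "E p x" and foll: "follow T E (T ! p ! x) xs = Some q"
    by (auto split: if_splits)
  have "root_edge n m T p x" using Cons.prems E by auto
  then have edge: "coxeter_cong n m ([x] @ root_word T p @ [x]) (root_word T (T ! p ! x))"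
    by (simp add: root_edge_def)
  have "coxeter_cong n m (rev xs @ ([x] @ root_word T p @ [x]) @ xs)
      (rev xs @ root_word T (T ! p ! x) @ xs)"
    using Cons.prems by (intro coxeter_cong_ctxt[OF edge]) (auto simp: in_lists_conv_set)
  moreover have "coxeter_cong n m (rev xs @ root_word T (T ! p ! x) @ xs) (root_word T q)"
    using Cons.IH[OF foll] Cons.prems coxeter_cong_lists[OF edge] by auto
  ultimately show ?case by (auto intro: coxeter_cong.trans)
qed

lemma root_edge_reverse:
  assumes edge: "root_edge n m T k s" and inv: "T ! (T ! k ! s) ! s = k"
    and s: "s < n" "m s s = 1" and k: "root_word T k \<in> lists {..<n}"
  shows "root_edge n m T (T ! k ! s) s"
proof -
  let ?w = "root_word T k" and ?w' = "root_word T (T ! k ! s)"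
  have "coxeter_cong n m ([s] @ ([s] @ ?w @ [s]) @ [s]) ([s] @ ?w' @ [s])"
    using edge s by (intro coxeter_cong_ctxt) (auto simp: root_edge_def)
  moreover have "coxeter_cong n m ([] @ [s, s] @ (?w @ [s, s])) ([] @ (?w @ [s, s]))"
    using s k by (intro coxeter_cong_cancel) auto
  moreover have "coxeter_cong n m (?w @ [s, s] @ []) (?w @ [])"
    using s k by (intro coxeter_cong_cancel) auto
  ultimately have "coxeter_cong n m ([s] @ ?w' @ [s]) ?w"
    by simp (meson coxeter_cong.sym coxeter_cong.trans)
  then show ?thesis by (simp add: root_edge_def inv)
qed

lemma root_edge_first_letter:
  assumes a: "a = hd (root_word T k)" and le: "T ! k ! a \<le> k"
    and len: "length (T ! k) = n" and lt: "a < n" "m a a = 1" and T: "root_word T (T ! k ! a) \<in> lists {..<n}"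
  shows "root_edge n m T k a"
proof (cases "find (\<lambda>s. T ! k ! s < k) [0..<length (T ! k)]")
  case None
  then have w: "root_word T k = [k]" by (simp add: root_word.simps)
  show ?thesis
  proof (cases "T ! k ! k = k")
    case True
    then show ?thesis
      using coxeter_cong_cancel[of "[]" n "[k]" k m] lt a w by (simp add: root_edge_def)
  next
    case False
    then have "T ! k ! k < k" using le a w by simp
    then have "find (\<lambda>s. T ! k ! s < k) [0..<length (T ! k)] \<noteq> None"
      using lt a w len by (auto simp: find_None_iff)
    then show ?thesis using None by simp
  qed
next
  case (Some s)
  then have w: "root_word T k = s # root_word T (T ! k ! s) @ [s]"
    by (subst root_word.simps) simp
  then have s: "s = a" using a by simp
  let ?w' = "root_word T (T ! k ! a)"
  have "coxeter_cong n m ([] @ [a, a] @ (?w' @ [a, a])) ([] @ (?w' @ [a, a]))"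
    using lt T by (intro coxeter_cong_cancel) auto
  moreover have "coxeter_cong n m (?w' @ [a, a] @ []) (?w' @ [])"
    using lt T by (intro coxeter_cong_cancel) auto
  ultimately show ?thesis
    using w s by (auto simp: root_edge_def intro: coxeter_cong.trans)
qed

text \<open>If the conjugated word followed by the reverse of the claimed one is a relator, the two
  agree in the group, since the reverse of a word is its inverse.\<close>

lemma root_edge_relator:
  assumes eq: "[s] @ root_word T k @ [s] @ rev (root_word T (T ! k ! s)) = concat (replicate (m s a) [s, a])"
    and lt: "s < n" "a < n" and diag: "\<forall>i<n. m i i = 1"
    and k: "root_word T k \<in> lists {..<n}" and k': "root_word T (T ! k ! s) \<in> lists {..<n}"
  shows "root_edge n m T k s"
proof -
  let ?u = "[s] @ root_word T k @ [s]" and ?w' = "root_word T (T ! k ! s)"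
  have "coxeter_cong n m (?u @ rev ?w') []"
    using coxeter_cong.rel[of "[]" n "[]" s a m] eq lt by simp
  then have "coxeter_cong n m ([] @ (?u @ rev ?w') @ ?w') ([] @ [] @ ?w')"
    using k' by (rule coxeter_cong_ctxt[OF _ lists.Nil])
  moreover have "coxeter_cong n m (?u @ (rev ?w' @ ?w') @ []) (?u @ [] @ [])"
    using k lt k' by (intro coxeter_cong_ctxt coxeter_cong_rev_cancel diag) auto
  ultimately show ?thesis
    unfolding root_edge_def by simp (meson coxeter_cong.sym coxeter_cong.trans)
qed

text \<open>The Todd-Coxeter deduction: with \<open>c = a s a \<dots> a\<close>, the relator is \<open>c s\<close>, so \<open>s\<close> equals both \<open>c\<close>
  and the reverse of \<open>c\<close>, and conjugation by \<open>s\<close> may be carried out along the path \<open>c\<close>.\<close>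

lemma root_edge_follow:
  assumes foll: "follow T E k (concat (replicate (m a s - 1) [a, s]) @ [a]) = Some (T ! k ! s)"
    and E: "\<And>p x. E p x \<Longrightarrow> x < n \<Longrightarrow> root_edge n m T p x"
    and lt: "s < n" "a < n" and diag: "\<forall>i<n. m i i = 1" and pos: "0 < m a s"
    and k: "root_word T k \<in> lists {..<n}"
  shows "root_edge n m T k s"
proof -
  define c where "c = concat (replicate (m a s - 1) [a, s]) @ [a]"
  have c: "c \<in> lists {..<n}" using lt by (auto simp: c_def in_lists_conv_set)
  have rc: "rev c \<in> lists {..<n}" using c by (simp add: in_lists_conv_set)
  obtain j where j: "m a s = Suc j" using pos by (cases "m a s") auto
  have relator: "c @ [s] = concat (replicate (m a s) [a, s])"
    by (simp add: c_def j replicate_append_same[symmetric] del: replicate_append_same)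
  have "coxeter_cong n m (c @ [s]) []"
    using coxeter_cong.rel[of "[]" n "[]" a s m] lt by (simp add: relator)
  then have cs: "coxeter_cong n m (rev c @ (c @ [s]) @ []) (rev c @ [] @ [])"
    using rc by (intro coxeter_cong_ctxt) auto
  have "coxeter_cong n m ([] @ (rev c @ c) @ [s]) ([] @ [] @ [s])"
    using lt by (intro coxeter_cong_ctxt coxeter_cong_rev_cancel c diag) auto
  then have s_rc: "coxeter_cong n m [s] (rev c)"
    using cs by simp (meson coxeter_cong.sym coxeter_cong.trans)
  have "coxeter_cong n m (c @ [s, s] @ []) (c @ [])"
    using c lt diag by (intro coxeter_cong_cancel) auto
  moreover have "coxeter_cong n m ([] @ (c @ [s]) @ [s]) ([] @ [] @ [s])"
    using lt \<open>coxeter_cong n m (c @ [s]) []\<close> by (intro coxeter_cong_ctxt) auto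
  ultimately have sc: "coxeter_cong n m [s] c"
    by simp (meson coxeter_cong.sym coxeter_cong.trans)
  have "coxeter_cong n m ([s] @ root_word T k @ [s]) (rev c @ root_word T k @ c)"
    using k by (intro coxeter_cong_append s_rc sc coxeter_cong.refl)
  moreover have "coxeter_cong n m (rev c @ root_word T k @ c) (root_word T (T ! k ! s))"
    using follow_conj[OF foll[folded c_def] c E k] .
  ultimately show ?thesis unfolding root_edge_def by (rule coxeter_cong.trans)
qed


text \<open>It suffices to treat edges that do not lead to a larger index, as the others are their
  reversals. They are established by strong induction on the index of their starting point,
  which makes all earlier edges available.\<close>

lemma root_table_edge:
  assumes table: "root_table n m T" and diag: "\<forall>i<n. m i i = 1"
    and k: "k < length T" and s: "s < n"
  shows "root_edge n m T k s"
proof -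
  have w: "root_word T k \<in> lists {..<n}" and len: "length (T ! k) = n"
    and le: "T ! k ! hd (root_word T k) \<le> k"
    if "k < length T" for k
    using table that by (auto simp: root_table_def list_all_iff in_lists_conv_set)
  have T: "T ! k ! s < length T" and inv: "T ! (T ! k ! s) ! s = k"
    and ok: "T ! k ! s \<le> k \<Longrightarrow> edge_ok m T k s"
    if "k < length T" "s < n" for k s
    using table that by (auto simp: root_table_def)
  have down: "root_edge n m T k s" if "k < length T" "s < n" "T ! k ! s \<le> k" for k s
    using that
  proof (induction k arbitrary: s rule: less_induct)
    case (less k)
    define a where "a = hd (root_word T k)"
    have a: "a < n"
      using w[OF less.prems(1)] root_word_not_Nil[of T k] by (auto simp: a_def in_lists_conv_set)
    have wk: "root_word T k \<in> lists {..<n}" and wk': "root_word T (T ! k ! s) \<in> lists {..<n}"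
      using w T less.prems by auto
    have tree: "root_edge n m T k a"
      using less.prems a w T
      by (intro root_edge_first_letter[OF a_def] len diag[rule_format]) (auto simp: a_def le)
    have earlier: "root_edge n m T p x" if "earlier_edge T k p x" and x: "x < n" for p x
    proof -
      have p: "p < length T" using that less.prems by (auto simp: earlier_edge_def)
      consider "p < k" "T ! p ! x < k" | "x = a" "p = k" | "x = a" "T ! p ! x = k"
        using \<open>earlier_edge T k p x\<close> unfolding earlier_edge_def a_def by blast
      then show ?thesis
      proof cases
        case 1
        show ?thesis
        proof (cases "T ! p ! x \<le> p")
          case True
          then show ?thesis using less.IH[OF 1(1) p x] by simp
        next
          case False
          then have "root_edge n m T (T ! p ! x) x"
            using less.IH[OF 1(2) T[OF p x] x] inv[OF p x] by simp
          then show ?thesis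
            using root_edge_reverse[of n m T "T ! p ! x" x] inv[OF p x] inv[OF T[OF p x] x]
              x diag[rule_format, OF x] w[OF T[OF p x]] by simp
        qed
      next
        case 2
        then show ?thesis using tree by simp
      next
        case 3
        then have "T ! k ! a = p" using inv[OF p x] by simp
        then show ?thesis
          using root_edge_reverse[OF tree inv[OF less.prems(1) a] a diag[rule_format, OF a] wk] 3 by simp
      qed
    qed
    show ?case
      using ok[OF less.prems] unfolding edge_ok_def Let_def a_def[symmetric]
    proof (elim disjE conjE)
      assume "s = a"
      then show ?thesis using tree by simp
    next
      assume "[s] @ root_word T k @ [s] @ rev (root_word T (T ! k ! s)) = concat (replicate (m s a) [s, a])"
      then show ?thesis using root_edge_relator less.prems(2) a diag wk wk' by blast
    next
      assume "0 < m a s"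
        and "follow T (earlier_edge T k) k (concat (replicate (m a s - 1) [a, s]) @ [a])
          = Some (T ! k ! s)"
      then show ?thesis using root_edge_follow earlier less.prems(2) a diag wk by blast
    qed
  qed
  show ?thesis
  proof (cases "T ! k ! s \<le> k")
    case True
    then show ?thesis using down k s by simp
  next
    case False
    then have "root_edge n m T (T ! k ! s) s"
      using down[OF T[OF k s] s] inv[OF k s] by simp
    then show ?thesis
      using root_edge_reverse[of n m T "T ! k ! s" s] inv[OF k s] inv[OF T[OF k s] s]
        s diag[rule_format, OF s] w[OF T[OF k s]] by simp
  qed
qed

text \<open>Conjugating a generator by a word amounts to a walk in the table that starts at a simple
  root.\<close>

lemma reflections_subset_root_words:
  assumes table: "root_table n m T" and diag: "\<forall>i<n. m i i = 1"
  shows "reflections (coxeter_group n m) (coxeter_gens n m)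
    \<subseteq> (\<lambda>k. word_class n m (root_word T k)) ` {..<length T}"
proof -
  have "\<exists>k<length T. coxeter_cong n m (u @ [i] @ rev u) (root_word T k)"
    if "u \<in> lists {..<n}" "i < n" for u i
    using that
  proof (induction u)
    case Nil
    then have "i < length T" "root_word T i = [i]"
      using table by (auto simp: root_table_def)
    then show ?case using Nil by (auto intro!: exI[of _ i] coxeter_cong.refl)
  next
    case (Cons s u)
    then obtain k where k: "k < length T" "coxeter_cong n m (u @ [i] @ rev u) (root_word T k)"
      by auto
    have s: "s < n" using Cons by simp
    have "coxeter_cong n m ([s] @ (u @ [i] @ rev u) @ [s]) ([s] @ root_word T k @ [s])"
      using k s by (intro coxeter_cong_ctxt) auto
    moreover have "coxeter_cong n m ([s] @ root_word T k @ [s]) (root_word T (T ! k ! s))"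
      using root_table_edge[OF table diag k(1) s] by (simp add: root_edge_def)
    ultimately have "coxeter_cong n m ((s # u) @ [i] @ rev (s # u)) (root_word T (T ! k ! s))"
      by (auto intro: coxeter_cong.trans)
    moreover have "T ! k ! s < length T" using table k(1) s by (simp add: root_table_def)
    ultimately show ?case by blast
  qed
  then show ?thesis
    unfolding reflections_coxeter_group[where m = m, OF diag]
    by (auto simp: image_iff) (metis append_Cons append_Nil word_class_eq_iff coxeter_cong_lists in_listsI in_listsD lessThan_iff)
qed

theorem Ric_H_coxeter_group_ge:
  assumes table: "root_table n m T" and diag: "\<forall>i<n. m i i = 1" and n: "0 < n"
  shows "Ric_H (coxeter_group n m) (coxeter_gens n m) \<ge> ereal (2 - real (length T))"
proof -
  let ?R = "reflections (coxeter_group n m) (coxeter_gens n m)"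
  note sub = reflections_subset_root_words[OF table diag]
  have fin: "finite ?R" by (rule finite_subset[OF sub], intro finite_imageI finite_lessThan)
  have "card ?R \<le> card ((\<lambda>k. word_class n m (root_word T k)) ` {..<length T})"
    using sub by (intro card_mono finite_imageI finite_lessThan)
  also have "\<dots> \<le> length T" using card_image_le[of "{..<length T}"] by simp
  finally have card: "card ?R \<le> length T" .
  obtain s where "s \<in> coxeter_gens n m" "s \<noteq> \<one>\<^bsub>coxeter_group n m\<^esub>"
    using coxeter_generators(3)[where m = m, OF diag n] by blast
  then have "Ric_H (coxeter_group n m) (coxeter_gens n m) \<ge> ereal (2 - real (card ?R))"
    by (intro Ric_H_ge_card_reflections group_coxeter_group coxeter_generators(1,2)[where m = m, OF diag n]
        diag[rule_format] fin)
  moreover have "ereal (2 - real (length T)) \<le> ereal (2 - real (card ?R))" using card by simp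
  ultimately show ?thesis by (rule order_trans[rotated])
qed


section \<open>The types \<open>F\<^sub>4\<close>, \<open>E\<^sub>6\<close> and \<open>H\<^sub>3\<close>\<close>

text \<open>For the types \<open>F\<^sub>4\<close>, \<open>E\<^sub>6\<close> and \<open>H\<^sub>3\<close> the tables were obtained by letting the simple
  reflections act on the root system of the geometric representation. The roots are numbered in
  the order in which a breadth-first search from the simple roots meets them.\<close>

definition F4_roots :: "nat list list" where
  "F4_roots =
   [[0,4,0,0], [4,1,5,1], [2,6,2,7], [3,3,7,3], [1,0,8,4], [8,5,1,9], [10,2,6,11],
    [7,11,3,2], [5,12,4,13], [13,9,9,5], [6,10,10,14], [14,7,15,6], [12,8,12,16],
    [9,16,13,8], [11,14,17,10], [17,15,11,15], [16,13,18,12], [15,19,14,17], [18,20,16,18],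
    [19,17,21,19], [22,18,20,20], [21,21,19,23], [20,22,22,22], [23,23,23,21]]"

definition E6_roots :: "nat list list" where
  "E6_roots =
   [[0,6,0,0,0,0], [6,1,7,1,1,1], [2,7,2,8,2,9], [3,3,8,3,10,3], [4,4,4,10,4,4],
    [5,5,9,5,5,5], [1,0,11,6,6,6], [11,2,1,12,7,13], [8,12,3,2,14,15], [9,13,5,15,9,2],
    [10,10,14,4,3,10], [7,11,6,16,11,17], [16,8,12,7,18,19], [17,9,13,19,13,7],
    [14,18,10,14,8,20], [15,19,15,9,20,8], [12,16,16,11,21,22], [13,17,17,22,17,11],
    [21,14,18,18,12,23], [22,15,24,13,23,12], [20,23,20,20,15,14], [18,21,21,21,16,25],
    [19,22,26,17,25,16], [25,20,27,23,19,18], [26,24,19,24,27,24], [23,25,28,25,22,21],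
    [24,29,22,26,28,26], [28,27,23,30,24,27], [27,31,25,32,26,28], [29,26,29,29,31,29],
    [32,30,30,27,30,30], [31,28,31,33,29,31], [30,33,32,28,32,32], [33,32,34,31,33,33],
    [34,34,33,34,34,35], [35,35,35,35,35,34]]"

definition H3_roots :: "nat list list" where
  "H3_roots =
   [[0,3,0], [4,1,5], [2,5,2], [6,0,7], [1,6,8], [8,2,1], [3,4,9], [9,7,3], [5,10,4],
    [7,11,6], [12,8,11], [13,9,10], [10,12,13], [11,14,12], [14,13,14]]"

lemma F4_root_table: "root_table 4 F4_matrix F4_roots"
  by code_simp

lemma E6_root_table: "root_table 6 E6_matrix E6_roots"
  by code_simp

lemma H3_root_table: "root_table 3 H3_matrix H3_roots"
  by code_simp

theorem proposition20:
  shows "Ric_H (coxeter_group 4 F4_matrix) (coxeter_gens 4 F4_matrix) \<ge> -28 \<and>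
         Ric_H (coxeter_group 6 E6_matrix) (coxeter_gens 6 E6_matrix) \<ge> -46 \<and>
         Ric_H (coxeter_group 3 H3_matrix) (coxeter_gens 3 H3_matrix) \<ge> -14"
proof (intro conjI)
  show "Ric_H (coxeter_group 4 F4_matrix) (coxeter_gens 4 F4_matrix) \<ge> -28"
    by (rule order_trans[OF _ Ric_H_coxeter_group_ge[OF F4_root_table]])
      (simp_all add: F4_matrix_def coxeter_matrix_def F4_roots_def)
  show "Ric_H (coxeter_group 6 E6_matrix) (coxeter_gens 6 E6_matrix) \<ge> -46"
    by (rule order_trans[OF _ Ric_H_coxeter_group_ge[OF E6_root_table]])
      (simp_all add: E6_matrix_def coxeter_matrix_def E6_roots_def)
  show "Ric_H (coxeter_group 3 H3_matrix) (coxeter_gens 3 H3_matrix) \<ge> -14"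
    by (rule order_trans[OF _ Ric_H_coxeter_group_ge[OF H3_root_table]])
      (simp_all add: H3_matrix_def coxeter_matrix_def H3_roots_def)
qed

end
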